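(* Let $f \in C(\mathbb{T})$ and let $(s_{n_j} f)_j$ be a subsequence of $(s_n f)_n$. Then there is a dense $G_\delta$ subset $E$ of $\mathbb{T}$ such that for every $t \in E$ a subsequence of $(s_{n_j} f(t))_j$ (which may depend on $t$) tends to $f(t)$.
   Context: $\mathbb{T} = \mathbb{R}/2\pi\mathbb{Z}$ is the unit circle. $C(\mathbb{T})$ is the space of continuous functions $f : \mathbb{T} \to \mathbb{C}$. For $f \in C(\mathbb{T})$ and $n \in \mathbb{N}$, $s_n f$ denotes the $n$-th partial sum of the Fourier series of $f$, i.e. $(s_n f)(t) = \sum_{k=-n}^{n} \hat f(k) e^{ikt}$ with $\hat f(k) = \frac{1}{2\pi}\int_{\mathbb{T}} f(s) e^{-iks}\,ds$. A subsequence corresponds to a strictly increasing sequence of indices $(n_j)_j$. *)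

theory Defs
  imports "HOL-Analysis.Analysis" "HOL-Library.Real_Mod"
begin

quotient_type circle = real / "\<lambda>x y. [x = y] (rmod (2 * pi))"
  morphisms rep_circle to_circle
  by (intro equivpI reflpI sympI transpI) (auto intro: rcong_sym rcong_trans)

instantiation circle :: topological_space
begin

(* the quotient topology: the finest one making the projection continuous *)
definition open_circle :: "circle set \<Rightarrow> bool" where
  "open_circle U \<longleftrightarrow> open (to_circle -` U)"

instance
proof
  show "open (UNIV :: circle set)"
    by (simp add: open_circle_def)
next
  fix S T :: "circle set"
  assume "open S" "open T"
  then show "open (S \<inter> T)"
    by (simp add: open_circle_def vimage_Int open_Int)
next
  fix K :: "circle set set"
  assume "\<forall>S\<in>K. open S"
  then show "open (\<Union>K)"
    by (auto simp: open_circle_def vimage_Union)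
qed

end

(* t \<mapsto> exp (i k t), which is well defined modulo 2 pi because k is an integer *)
lift_definition circle_char :: "int \<Rightarrow> circle \<Rightarrow> complex" is
  "\<lambda>k x. cis (of_int k * x)"
proof -
  fix k :: int and x y :: real
  assume "[x = y] (rmod (2 * pi))"
  then obtain n :: int where n: "y = x + of_int n * (2 * pi)"
    by (auto simp: rcong_altdef)
  have "cis (of_int k * y) = cis (of_int k * x) * cis (2 * pi * of_int (k * n))"
    by (simp add: n cis_mult algebra_simps)
  also have "\<dots> = cis (of_int k * x)"
    by (subst cis_multiple_2pi) simp_all
  finally show "cis (of_int k * x) = cis (of_int k * y)"
    by simp
qed

(* total mass 2 pi: Lebesgue measure on a fundamental domain, not normalised *)
definition circle_integral :: "(circle \<Rightarrow> complex) \<Rightarrow> complex" where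
  "circle_integral g = (LINT s:{0..2 * pi}|lborel. g (to_circle s))"

definition fourier_coeff :: "(circle \<Rightarrow> complex) \<Rightarrow> int \<Rightarrow> complex" where
  "fourier_coeff f k =
     complex_of_real (1 / (2 * pi)) * circle_integral (\<lambda>s. f s * circle_char (- k) s)"

definition fourier_partial_sum :: "nat \<Rightarrow> (circle \<Rightarrow> complex) \<Rightarrow> circle \<Rightarrow> complex" where
  "fourier_partial_sum n f t =
     (\<Sum>k\<in>{- int n..int n}. fourier_coeff f k * circle_char k t)"

end

theory Submission
  imports Defs
begin

text \<open>
  The partial sums \<open>s\<^sub>N f\<close> need not converge to \<open>f\<close> at any prescribed point, but they converge to
  \<open>f\<close> in the mean square, and that already forbids them to stay away from \<open>f\<close> on a whole arc.
  Let \<open>F k\<close> be the set of those \<open>t\<close> with \<open>\<bar>s\<^bsub>n j\<^esub> f(t) - f(t)\<bar> < 1 / (k + 1)\<close> for some \<open>j \<ge> k\<close>.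
  It is open, because every \<open>s\<^sub>N f\<close> is continuous. It is also dense: on an arc of length \<open>l\<close> that
  misses \<open>F k\<close>, all the differences with \<open>j \<ge> k\<close> have modulus at least \<open>1 / (k + 1)\<close>, so their
  square integrals are at least \<open>l / (k + 1)\<^sup>2\<close> (\<open>square_integral_ge_arc\<close>), whereas they tend to \<open>0\<close>
  (\<open>square_integral_partial_sum_tendsto_0\<close>). By Baire's theorem (\<open>circle_Baire\<close>) the intersection
  \<open>E\<close> of the \<open>F k\<close> is dense, and at each of its points indices can be chosen one after the other
  so that the error tends to \<open>0\<close> (\<open>ex_strict_mono_tendsto\<close>).

  Mean-square convergence rests on two facts. First, \<open>s\<^sub>N f\<close> is the orthogonal projection of \<open>f\<close> to
  the trigonometric polynomials of degree at most \<open>N\<close>, hence it is the best approximation among them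
  (\<open>square_integral_best_approx\<close>). Second, trigonometric polynomials are uniformly dense
  (\<open>trig_poly_dense\<close>). The latter is the Stone-Weierstrass theorem on the unit circle of the complex
  plane, because a real polynomial in the coordinates of \<open>exp (i t)\<close> is a trigonometric polynomial
  in \<open>t\<close>.
\<close>

section \<open>Characters and integration on the circle\<close>

lemma continuous_on_circle_iff:
  fixes g :: "circle \<Rightarrow> 'a::topological_space"
  shows "continuous_on UNIV g \<longleftrightarrow> continuous_on UNIV (\<lambda>x. g (to_circle x))"
  by (simp add: continuous_on_open_vimage open_circle_def vimage_def)

lemma circle_char_to_circle: "circle_char k (to_circle x) = cis (of_int k * x)"
  by transfer simp

lemma circle_cases: obtains x where "t = to_circle x"
  by (metis Quotient_abs_rep Quotient_circle)

lemma continuous_circle_char [continuous_intros]: "continuous_on UNIV (circle_char k)"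
  unfolding continuous_on_circle_iff circle_char_to_circle cis_conv_exp
  by (intro continuous_intros)

lemma circle_char_0: "circle_char 0 t = 1"
  by transfer simp

lemma circle_char_add: "circle_char (j + k) t = circle_char j t * circle_char k t"
  by transfer (simp add: cis_mult algebra_simps)

lemma cnj_circle_char: "cnj (circle_char k t) = circle_char (- k) t"
  by transfer (simp add: cis_cnj)

lemma norm_circle_char: "norm (circle_char k t) = 1"
  by transfer simp

lemma to_circle_eq_iff_cis: "to_circle x = to_circle y \<longleftrightarrow> cis x = cis y"
  by (simp add: circle.abs_eq_iff cis_eq_iff)

lemma set_integrable_circle:
  fixes g :: "circle \<Rightarrow> 'a::euclidean_space"
  assumes "continuous_on UNIV g"
  shows "set_integrable lborel {0..2 * pi} (\<lambda>x. g (to_circle x))"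
  using assms unfolding continuous_on_circle_iff
  by (intro borel_integrable_atLeastAtMost') (rule continuous_on_subset, auto)

lemma circle_integral_add:
  assumes "continuous_on UNIV f" "continuous_on UNIV g"
  shows "circle_integral (\<lambda>t. f t + g t) = circle_integral f + circle_integral g"
  unfolding circle_integral_def using assms
  by (intro set_integral_add set_integrable_circle)

lemma circle_integral_diff:
  assumes "continuous_on UNIV f" "continuous_on UNIV g"
  shows "circle_integral (\<lambda>t. f t - g t) = circle_integral f - circle_integral g"
  unfolding circle_integral_def using assms
  by (intro set_integral_diff set_integrable_circle)

lemma circle_integral_cmult: "circle_integral (\<lambda>t. c * f t) = c * circle_integral f"
  unfolding circle_integral_def by simp

lemma circle_integral_cnj: "circle_integral (\<lambda>t. cnj (f t)) = cnj (circle_integral f)"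
  unfolding circle_integral_def set_lebesgue_integral_def
  by (subst Bochner_Integration.integral_cnj[symmetric]) simp

lemma circle_integral_sum:
  assumes "finite K" "\<And>k. k \<in> K \<Longrightarrow> continuous_on UNIV (g k)"
  shows "circle_integral (\<lambda>t. \<Sum>k\<in>K. g k t) = (\<Sum>k\<in>K. circle_integral (g k))"
  using assms
proof (induction K rule: finite_induct)
  case empty
  then show ?case by (simp add: circle_integral_def)
next
  case (insert k K)
  then show ?case
    by (simp add: circle_integral_add continuous_on_sum)
qed

text \<open>
  For \<open>k \<noteq> 0\<close> the character has the primitive \<open>exp (i k x) / (i k)\<close>, which is itself periodic.
\<close>
lemma circle_integral_char: "circle_integral (circle_char k) = (if k = 0 then 2 * pi else 0)"
proof (cases "k = 0")
  case True
  then show ?thesis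
    by (simp add: circle_integral_def circle_char_0 set_lebesgue_integral_def scaleR_conv_of_real)
next
  case False
  let ?F = "\<lambda>x. cis (of_int k * x) / (\<i> * of_int k)"
  have "circle_integral (circle_char k) = ?F (2 * pi) - ?F 0"
    unfolding circle_integral_def circle_char_to_circle set_lebesgue_integral_def
  proof (rule integral_FTC_atLeastAtMost)
    fix x
    show "(?F has_vector_derivative cis (of_int k * x)) (at x within {0..2 * pi})"
      unfolding cis_conv_exp using False
      by (auto intro!: derivative_eq_intros has_vector_derivative_real_field simp: mult_ac)
  qed (auto simp: cis_conv_exp intro!: continuous_intros)
  also have "\<dots> = 0"
    using cis_multiple_2pi[of "of_int k"] by (simp add: mult.commute)
  finally show ?thesis using False by simp
qed

section \<open>Trigonometric polynomials\<close>

text \<open>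
  The parameter \<open>N\<close> is an upper bound on the degree. Generating the class from monomials by addition,
  rather than by a coefficient function, makes linear statements such as
  \<open>partial_sum_orthogonal\<close> immediate by rule induction.
\<close>
inductive trig_poly :: "nat \<Rightarrow> (circle \<Rightarrow> complex) \<Rightarrow> bool" for N where
  monomial: "\<bar>k\<bar> \<le> int N \<Longrightarrow> trig_poly N (\<lambda>t. c * circle_char k t)"
| add: "trig_poly N p \<Longrightarrow> trig_poly N q \<Longrightarrow> trig_poly N (\<lambda>t. p t + q t)"

lemma trig_poly_mono: "trig_poly M p \<Longrightarrow> M \<le> N \<Longrightarrow> trig_poly N p"
  by (induction rule: trig_poly.induct) (auto intro: trig_poly.intros)

lemma trig_poly_const: "trig_poly N (\<lambda>_. c)"
  using trig_poly.monomial[of 0 N c] by (simp add: circle_char_0)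

lemma trig_poly_mult_monomial:
  assumes "trig_poly M p" "\<bar>k\<bar> \<le> int N"
  shows "trig_poly (M + N) (\<lambda>t. c * circle_char k t * p t)"
  using assms(1)
proof (induction rule: trig_poly.induct)
  case (monomial j d)
  have "trig_poly (M + N) (\<lambda>t. (c * d) * circle_char (k + j) t)"
    using monomial assms(2) by (intro trig_poly.monomial) linarith
  then show ?case by (simp add: circle_char_add mult_ac)
next
  case (add p q)
  then show ?case using trig_poly.add by (simp add: distrib_left)
qed

lemma trig_poly_mult:
  assumes "trig_poly M p" "trig_poly N q"
  shows "trig_poly (M + N) (\<lambda>t. p t * q t)"
  using assms(2)
proof (induction rule: trig_poly.induct)
  case (monomial k c)
  then show ?case using trig_poly_mult_monomial[OF assms(1)] by (simp add: mult_ac)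
next
  case (add p q)
  then show ?case using trig_poly.add by (simp add: distrib_left)
qed

lemma continuous_trig_poly: "trig_poly N p \<Longrightarrow> continuous_on UNIV p"
  by (induction rule: trig_poly.induct) (intro continuous_intros | assumption)+

lemma trig_poly_sum:
  assumes "finite K" "\<And>k. k \<in> K \<Longrightarrow> trig_poly N (g k)"
  shows "trig_poly N (\<lambda>t. \<Sum>k\<in>K. g k t)"
  using assms
proof (induction K rule: finite_induct)
  case empty
  then show ?case using trig_poly_const[of N 0] by simp
next
  case (insert k K)
  then show ?case by (simp add: trig_poly.add)
qed

lemma trig_poly_diff:
  assumes "trig_poly N p" "trig_poly N q"
  shows "trig_poly N (\<lambda>t. p t - q t)"
proof -
  have "trig_poly (0 + N) (\<lambda>t. - 1 * q t)"
    by (rule trig_poly_mult[OF trig_poly_const assms(2)])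
  with assms(1) show ?thesis using trig_poly.add[of N p "\<lambda>t. - q t"] by simp
qed

lemma trig_poly_fourier_partial_sum: "trig_poly N (fourier_partial_sum N f)"
proof -
  have "trig_poly N (\<lambda>t. \<Sum>k\<in>{- int N..int N}. fourier_coeff f k * circle_char k t)"
    by (rule trig_poly_sum) (auto intro!: trig_poly.monomial)
  then show ?thesis
    by (simp add: fourier_partial_sum_def[abs_def])
qed

text \<open>
  By the closure properties above only real-linear forms \<open>h\<close> matter, and for these Euler's formulas
  express the real and imaginary part of \<open>exp (i t)\<close> by \<open>exp (i t)\<close> and \<open>exp (- i t)\<close>.
\<close>
lemma trig_poly_real_polynomial:
  assumes "real_polynomial_function p"
  shows "\<exists>N. trig_poly N (\<lambda>t. of_real (p (circle_char 1 t)))"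
  using assms
proof (induction rule: real_polynomial_function.induct)
  case (linear h)
  interpret bounded_linear h by fact
  have expand: "complex_of_real (h (circle_char 1 t)) =
      ((h 1 - \<i> * h \<i>) / 2) * circle_char 1 t + ((h 1 + \<i> * h \<i>) / 2) * circle_char (- 1) t"
    for t
  proof -
    let ?z = "circle_char 1 t"
    have "h ?z = h (Re ?z *\<^sub>R 1 + Im ?z *\<^sub>R \<i>)"
      by (rule arg_cong[of _ _ h]) (simp add: complex_eq_iff)
    then have "h ?z = Re ?z * h 1 + Im ?z * h \<i>"
      by (simp add: add scaleR)
    then show ?thesis
      by (simp add: complex_eq_iff field_simps flip: cnj_circle_char)
  qed
  have "trig_poly 1 (\<lambda>t. complex_of_real (h (circle_char 1 t)))"
    unfolding expand by (intro trig_poly.intros) auto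
  then show ?case by blast
next
  case (const c)
  show ?case using trig_poly_const by blast
next
  case (add p q)
  then obtain M N where "trig_poly M (\<lambda>t. of_real (p (circle_char 1 t)))"
    "trig_poly N (\<lambda>t. of_real (q (circle_char 1 t)))"
    by blast
  then have "trig_poly (max M N) (\<lambda>t. of_real (p (circle_char 1 t)) + of_real (q (circle_char 1 t)))"
    by (intro trig_poly.add) (erule trig_poly_mono, simp)+
  then show ?case by auto
next
  case (mult p q)
  then show ?case using trig_poly_mult by fastforce
qed

lemma trig_poly_polynomial_function:
  fixes p :: "complex \<Rightarrow> complex"
  assumes "polynomial_function p"
  shows "\<exists>N. trig_poly N (\<lambda>t. p (circle_char 1 t))"
proof -
  have "real_polynomial_function (\<lambda>z. Re (p z))" "real_polynomial_function (\<lambda>z. Im (p z))"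
    using assms bounded_linear_Re bounded_linear_Im
    unfolding polynomial_function_def comp_def by blast+
  then obtain M N where MN: "trig_poly M (\<lambda>t. of_real (Re (p (circle_char 1 t))))"
    "trig_poly N (\<lambda>t. of_real (Im (p (circle_char 1 t))))"
    using trig_poly_real_polynomial by blast
  have "trig_poly (0 + N) (\<lambda>t. \<i> * of_real (Im (p (circle_char 1 t))))"
    by (rule trig_poly_mult[OF trig_poly_const MN(2)])
  then have "trig_poly (max M N) (\<lambda>t. of_real (Re (p (circle_char 1 t)))
      + \<i> * of_real (Im (p (circle_char 1 t))))"
    using MN(1) by (intro trig_poly.add) (erule trig_poly_mono, simp)+
  then show ?thesis
    by (auto simp: complex_eq[symmetric])
qed

section \<open>Uniform approximation\<close>

lemma to_circle_Arg: "z \<noteq> 0 \<Longrightarrow> to_circle (Arg z) = to_circle (Arg2pi z)"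
proof -
  assume "z \<noteq> 0"
  then have "cis (Arg2pi z) = z / of_real (norm z)"
    using Arg2pi_eq[of z] by (simp add: cis_conv_exp nonzero_eq_divide_eq mult.commute)
  with \<open>z \<noteq> 0\<close> show ?thesis
    by (simp add: to_circle_eq_iff_cis cis_Arg sgn_eq)
qed

text \<open>
  A function on the circle becomes a function on the punctured plane by composition with the argument.
  The jump of the principal argument along the negative axis disappears in the quotient: there the
  argument can be replaced by the one with values in \<open>[0, 2\<pi>)\<close>, which is continuous off the
  positive axis.
\<close>
lemma isCont_circle_Arg:
  fixes f :: "circle \<Rightarrow> complex"
  assumes f: "continuous_on UNIV f" and "z \<noteq> 0"
  shows "isCont (\<lambda>z. f (to_circle (Arg z))) z"
proof -
  have cont: "isCont (\<lambda>x. f (to_circle x)) x" for x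
    using f by (simp add: continuous_on_circle_iff continuous_on_eq_continuous_at)
  show ?thesis
  proof (cases "z \<in> \<real>\<^sub>\<le>\<^sub>0")
    case False
    then show ?thesis
      using isCont_o2[OF continuous_at_Arg cont] by blast
  next
    case True
    with \<open>z \<noteq> 0\<close> have "z \<notin> \<real>\<^sub>\<ge>\<^sub>0"
      using complex_nonneg_Reals_iff complex_nonpos_Reals_iff complex_eq_iff by force
    then have "isCont (\<lambda>z. f (to_circle (Arg2pi z))) z"
      using isCont_o2[OF continuous_at_Arg2pi cont] by blast
    moreover have "\<forall>\<^sub>F w in nhds z. f (to_circle (Arg w)) = f (to_circle (Arg2pi w))"
      using t1_space_nhds[OF \<open>z \<noteq> 0\<close>] by eventually_elim (simp add: to_circle_Arg)
    ultimately show ?thesis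
      by (simp add: isCont_cong)
  qed
qed

text \<open>
  Transported to the unit circle of the plane by the argument, \<open>f\<close> is within \<open>e\<close> of a polynomial in
  the two coordinates; pulled back along the first character, that polynomial is trigonometric.
\<close>
lemma trig_poly_dense:
  assumes f: "continuous_on UNIV f" and "0 < e"
  shows "\<exists>N p. trig_poly N p \<and> (\<forall>t. norm (f t - p t) < e)"
proof -
  let ?h = "\<lambda>z. f (to_circle (Arg z))"
  have "continuous_on (sphere 0 1) ?h"
    by (rule continuous_at_imp_continuous_on) (auto intro!: isCont_circle_Arg[OF f])
  from Stone_Weierstrass_polynomial_function[OF compact_sphere this \<open>0 < e\<close>]
  obtain g where g: "polynomial_function g" "\<And>z. z \<in> sphere 0 1 \<Longrightarrow> norm (?h z - g z) < e"
    by blast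
  have "norm (f t - g (circle_char 1 t)) < e" for t
  proof -
    obtain x where x: "t = to_circle x" by (rule circle_cases)
    then have "to_circle (Arg (circle_char 1 t)) = t"
      by (simp add: circle_char_to_circle to_circle_eq_iff_cis cis_Arg)
    then show ?thesis
      using g(2)[of "circle_char 1 t"] by (simp add: norm_circle_char)
  qed
  then show ?thesis
    using trig_poly_polynomial_function[OF g(1)] by blast
qed

section \<open>Mean-square convergence of Fourier series\<close>

text \<open>
  The square of the norm of \<open>L\<^sup>2\<close> for the measure of total mass \<open>2\<pi>\<close>.
\<close>
definition square_integral :: "(circle \<Rightarrow> complex) \<Rightarrow> real" where
  "square_integral g = (LINT s:{0..2 * pi}|lborel. (norm (g (to_circle s)))\<^sup>2)"

lemma circle_integral_mult_cnj: "circle_integral (\<lambda>t. g t * cnj (g t)) = of_real (square_integral g)"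
  unfolding circle_integral_def square_integral_def
  by (simp only: complex_norm_square[symmetric] set_integral_complex_of_real)

lemma square_integral_nonneg: "0 \<le> square_integral g"
  unfolding square_integral_def set_lebesgue_integral_def by (intro integral_nonneg_AE) auto

lemma circle_integral_partial_sum_times_char:
  assumes "\<bar>k\<bar> \<le> int N"
  shows "circle_integral (\<lambda>t. fourier_partial_sum N f t * circle_char (- k) t)
    = 2 * pi * fourier_coeff f k"
proof -
  have "circle_integral (\<lambda>t. fourier_partial_sum N f t * circle_char (- k) t)
      = circle_integral (\<lambda>t. \<Sum>j\<in>{- int N..int N}. fourier_coeff f j * circle_char (j - k) t)"
    using circle_char_add[of _ "- k"]
    by (simp add: fourier_partial_sum_def sum_distrib_right mult.assoc)
  also have "\<dots> = (\<Sum>j\<in>{- int N..int N}. fourier_coeff f j * circle_integral (circle_char (j - k)))"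
    by (subst circle_integral_sum) (auto simp: circle_integral_cmult intro!: continuous_intros)
  also have "\<dots> = (\<Sum>j\<in>{- int N..int N}. if j = k then 2 * pi * fourier_coeff f k else 0)"
    by (intro sum.cong) (auto simp: circle_integral_char)
  also have "\<dots> = 2 * pi * fourier_coeff f k"
    using assms by (subst sum.delta) auto
  finally show ?thesis .
qed

text \<open>
  Up to degree \<open>N\<close>, the functions \<open>f\<close> and \<open>s\<^sub>N f\<close> have the same Fourier coefficients, so their
  difference is orthogonal to every monomial that occurs in \<open>p\<close>.
\<close>
lemma partial_sum_orthogonal:
  assumes f: "continuous_on UNIV f" and "trig_poly N p"
  shows "circle_integral (\<lambda>t. (f t - fourier_partial_sum N f t) * cnj (p t)) = 0"
  using assms(2)
proof (induction rule: trig_poly.induct)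
  case (monomial k c)
  have s: "continuous_on UNIV (fourier_partial_sum N f)"
    by (rule continuous_trig_poly[OF trig_poly_fourier_partial_sum])
  have "circle_integral (\<lambda>t. (f t - fourier_partial_sum N f t) * cnj (c * circle_char k t))
    = cnj c * circle_integral (\<lambda>t. f t * circle_char (- k) t
        - fourier_partial_sum N f t * circle_char (- k) t)"
    by (simp add: cnj_circle_char algebra_simps flip: circle_integral_cmult)
  also have "\<dots> = cnj c * (circle_integral (\<lambda>t. f t * circle_char (- k) t)
        - circle_integral (\<lambda>t. fourier_partial_sum N f t * circle_char (- k) t))"
    by (subst circle_integral_diff) (auto intro!: continuous_intros f s)
  also have "\<dots> = 0"
    by (simp add: circle_integral_partial_sum_times_char[OF monomial] fourier_coeff_def)
  finally show ?case .
next
  case (add p q)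
  have s: "continuous_on UNIV (fourier_partial_sum N f)"
    by (rule continuous_trig_poly[OF trig_poly_fourier_partial_sum])
  have "circle_integral (\<lambda>t. (f t - fourier_partial_sum N f t) * cnj (p t + q t))
    = circle_integral (\<lambda>t. (f t - fourier_partial_sum N f t) * cnj (p t)
        + (f t - fourier_partial_sum N f t) * cnj (q t))"
    by (simp add: algebra_simps)
  also have "\<dots> = 0"
    using add add.hyps[THEN continuous_trig_poly]
    by (subst circle_integral_add) (auto intro!: continuous_intros f s)
  finally show ?case .
qed

text \<open>
  Pythagoras: \<open>f - p\<close> is the sum of \<open>u = f - s\<^sub>N f\<close> and the trigonometric polynomial
  \<open>v = s\<^sub>N f - p\<close>, and these are orthogonal.
\<close>
lemma square_integral_best_approx:
  assumes f: "continuous_on UNIV f" and p: "trig_poly N p"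
  shows "square_integral (\<lambda>t. f t - fourier_partial_sum N f t) \<le> square_integral (\<lambda>t. f t - p t)"
proof -
  define u where "u = (\<lambda>t. f t - fourier_partial_sum N f t)"
  define v where "v = (\<lambda>t. fourier_partial_sum N f t - p t)"
  have v: "trig_poly N v"
    unfolding v_def by (intro trig_poly_diff trig_poly_fourier_partial_sum p)
  have uv: "continuous_on UNIV u" "continuous_on UNIV v"
    unfolding u_def using f v trig_poly_fourier_partial_sum
    by (auto intro!: continuous_intros intro: continuous_trig_poly)
  have 0: "circle_integral (\<lambda>t. u t * cnj (v t)) = 0"
    unfolding u_def by (rule partial_sum_orthogonal[OF f v])
  have 1: "circle_integral (\<lambda>t. v t * cnj (u t)) = 0"
  proof -
    have "circle_integral (\<lambda>t. v t * cnj (u t)) = cnj (circle_integral (\<lambda>t. u t * cnj (v t)))"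
      by (simp add: mult.commute flip: circle_integral_cnj)
    with 0 show ?thesis by simp
  qed
  have "of_real (square_integral (\<lambda>t. f t - p t)) = circle_integral (\<lambda>t. (u t + v t) * cnj (u t + v t))"
    by (simp add: u_def v_def flip: circle_integral_mult_cnj)
  also have "\<dots> = circle_integral (\<lambda>t. u t * cnj (u t) + v t * cnj (v t) + u t * cnj (v t) + v t * cnj (u t))"
    by (simp add: algebra_simps)
  also have "\<dots> = circle_integral (\<lambda>t. u t * cnj (u t)) + circle_integral (\<lambda>t. v t * cnj (v t))"
    using uv by (simp add: circle_integral_add continuous_intros 0 1)
  also have "\<dots> = of_real (square_integral u + square_integral v)"
    by (simp add: circle_integral_mult_cnj)
  finally have "square_integral (\<lambda>t. f t - p t) = square_integral u + square_integral v"
    using of_real_eq_iff by blast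
  then show ?thesis
    using square_integral_nonneg[of v] by (simp add: u_def)
qed

lemma square_integral_le:
  assumes g: "continuous_on UNIV g" and le: "\<And>t. norm (g t) \<le> e"
  shows "square_integral g \<le> 2 * pi * e\<^sup>2"
proof -
  have "square_integral g \<le> (LINT s:{0..2 * pi}|lborel. e\<^sup>2)"
    unfolding square_integral_def
  proof (rule set_integral_mono)
    show "set_integrable lborel {0..2 * pi} (\<lambda>s. (norm (g (to_circle s)))\<^sup>2)"
      by (intro set_integrable_circle continuous_intros g)
    show "set_integrable lborel {0..2 * pi} (\<lambda>s. e\<^sup>2)"
      by (intro borel_integrable_atLeastAtMost' continuous_intros)
  qed (simp add: le power_mono)
  then show ?thesis
    by (simp add: set_lebesgue_integral_def)
qed

lemma square_integral_ge_arc: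
  assumes g: "continuous_on UNIV g" and cd: "0 \<le> c" "c \<le> d" "d \<le> 2 * pi" and "0 \<le> e"
    and le: "\<And>x. x \<in> {c..d} \<Longrightarrow> e \<le> norm (g (to_circle x))"
  shows "(d - c) * e\<^sup>2 \<le> square_integral g"
proof -
  have "(d - c) * e\<^sup>2 = (LINT s|lborel. indicator {c..d} s *\<^sub>R e\<^sup>2)"
    using cd by simp
  also have "\<dots> \<le> (LINT s|lborel. indicator {0..2 * pi} s *\<^sub>R (norm (g (to_circle s)))\<^sup>2)"
  proof (rule integral_mono)
    show "integrable lborel (\<lambda>s. indicator {c..d} s *\<^sub>R e\<^sup>2)"
      unfolding set_integrable_def[symmetric]
      by (intro borel_integrable_atLeastAtMost' continuous_intros)
    show "integrable lborel (\<lambda>s. indicator {0..2 * pi} s *\<^sub>R (norm (g (to_circle s)))\<^sup>2)"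
      unfolding set_integrable_def[symmetric]
      by (intro set_integrable_circle continuous_intros g)
    show "indicator {c..d} s *\<^sub>R e\<^sup>2 \<le> indicator {0..2 * pi} s *\<^sub>R (norm (g (to_circle s)))\<^sup>2" for s
      using cd le[of s] \<open>0 \<le> e\<close> by (auto simp: indicator_def intro: power_mono)
  qed
  finally show ?thesis
    by (simp add: square_integral_def set_lebesgue_integral_def)
qed

text \<open>
  A trigonometric polynomial that is uniformly close to \<open>f\<close> is close in the mean square, and by
  the best approximation property all partial sums of at least its degree are no worse.
\<close>
lemma square_integral_partial_sum_tendsto_0:
  assumes f: "continuous_on UNIV f"
  shows "(\<lambda>N. square_integral (\<lambda>t. f t - fourier_partial_sum N f t)) \<longlonglongrightarrow> 0"
proof (rule LIMSEQ_I)
  fix e :: real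
  assume "0 < e"
  \<comment> \<open>The uniform error \<open>d\<close> is chosen such that \<open>2\<pi> d\<^sup>2 = e / 2\<close>.\<close>
  define d where "d = sqrt (e / (4 * pi))"
  have d: "0 < d" "2 * pi * d\<^sup>2 < e"
    using \<open>0 < e\<close> by (auto simp: d_def)
  obtain M p where p: "trig_poly M p" "\<And>t. norm (f t - p t) < d"
    using trig_poly_dense[OF f d(1)] by blast
  have "norm (square_integral (\<lambda>t. f t - fourier_partial_sum N f t) - 0) < e" if "M \<le> N" for N
  proof -
    have "square_integral (\<lambda>t. f t - fourier_partial_sum N f t) \<le> square_integral (\<lambda>t. f t - p t)"
      by (rule square_integral_best_approx[OF f trig_poly_mono[OF p(1) that]])
    also have "\<dots> \<le> 2 * pi * d\<^sup>2"
      using p by (intro square_integral_le continuous_intros f) (auto intro: continuous_trig_poly less_imp_le)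
    finally show ?thesis
      using d(2) square_integral_nonneg by simp
  qed
  then show "\<exists>M. \<forall>N\<ge>M. norm (square_integral (\<lambda>t. f t - fourier_partial_sum N f t) - 0) < e"
    by blast
qed

section \<open>Density and Baire category on the circle\<close>

text \<open>
  The arc is sought in \<open>[0, 2\<pi>]\<close> because integrals over the circle are taken over this interval. A
  representative in \<open>[0, 2\<pi>)\<close> leaves room to its right, even if it is the left endpoint.
\<close>
lemma open_circle_contains_arc:
  assumes "open U" "U \<noteq> {}"
  obtains c d where "0 \<le> c" "c < d" "d \<le> 2 * pi" "to_circle ` {c..d} \<subseteq> U"
proof -
  obtain x where x: "to_circle x \<in> U"
    using assms(2) by (metis circle_cases ex_in_conv)
  define y where "y = x rmod (2 * pi)"
  have y: "0 \<le> y" "y < 2 * pi" "to_circle y \<in> U"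
  proof -
    show "0 \<le> y" "y < 2 * pi"
      by (simp_all add: y_def rmod_nonneg rmod_less)
    have "to_circle y = to_circle x"
      by (simp add: to_circle_eq_iff_cis y_def)
    with x show "to_circle y \<in> U" by simp
  qed
  have "open (to_circle -` U)"
    using assms(1) by (simp add: open_circle_def)
  then obtain e where e: "0 < e" "cball y e \<subseteq> to_circle -` U"
    using y(3) unfolding open_contains_cball by blast
  show ?thesis
  proof (rule that[of y "min (y + e) (2 * pi)"])
    have "{y..min (y + e) (2 * pi)} \<subseteq> cball y e"
      by (auto simp: dist_real_def)
    with e(2) show "to_circle ` {y..min (y + e) (2 * pi)} \<subseteq> U" by blast
  qed (use y e in auto)
qed

text \<open>
  The saturation of \<open>U\<close> is the union of its translates by multiples of \<open>2\<pi>\<close>.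
\<close>
lemma open_to_circle_image:
  assumes "open U"
  shows "open (to_circle ` U)"
proof -
  have "to_circle -` to_circle ` U = (\<Union>n::int. (\<lambda>x. of_int n * (2 * pi) + x) ` U)"
  proof (intro equalityI subsetI)
    fix x
    assume "x \<in> to_circle -` to_circle ` U"
    then obtain u where u: "u \<in> U" "to_circle u = to_circle x"
      by (metis imageE vimageD)
    then obtain n :: int where "x = u + of_int n * (2 * pi)"
      unfolding circle.abs_eq_iff rcong_altdef by blast
    with u show "x \<in> (\<Union>n::int. (\<lambda>x. of_int n * (2 * pi) + x) ` U)"
      by (auto simp: add.commute)
  next
    fix x
    assume "x \<in> (\<Union>n::int. (\<lambda>x. of_int n * (2 * pi) + x) ` U)"
    then obtain u and n :: int where u: "u \<in> U" "x = u + of_int n * (2 * pi)"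
      by (auto simp: add.commute)
    then have "to_circle u = to_circle x"
      unfolding circle.abs_eq_iff rcong_altdef by blast
    with u show "x \<in> to_circle -` to_circle ` U"
      by (metis imageI vimageI)
  qed
  also have "open \<dots>"
    using assms by (intro open_UN ballI open_translation)
  finally show ?thesis
    by (simp add: open_circle_def)
qed

lemma closure_eq_UNIV_iff:
  "closure S = UNIV \<longleftrightarrow> (\<forall>U. open U \<longrightarrow> U \<noteq> {} \<longrightarrow> U \<inter> S \<noteq> {})"
proof
  assume "closure S = UNIV"
  then show "\<forall>U. open U \<longrightarrow> U \<noteq> {} \<longrightarrow> U \<inter> S \<noteq> {}"
    using open_Int_closure_eq_empty[of _ S] by auto
next
  assume *: "\<forall>U. open U \<longrightarrow> U \<noteq> {} \<longrightarrow> U \<inter> S \<noteq> {}"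
  have "- closure S \<inter> S = {}"
    using closure_subset by blast
  with * have "- closure S = {}"
    by (meson closed_closure open_Compl)
  then show "closure S = UNIV" by blast
qed

text \<open>
  Baire's theorem is pulled back from the real line. The projection is open, so preimages of dense
  sets are dense; it is continuous and onto, so a set with dense preimage is dense.
\<close>
lemma circle_Baire:
  fixes F :: "nat \<Rightarrow> circle set"
  assumes op: "\<And>k. open (F k)" and dense: "\<And>k. closure (F k) = UNIV"
  shows "closure (\<Inter>k. F k) = UNIV"
proof -
  have dense_lift: "closure (to_circle -` F k) = UNIV" for k
    unfolding closure_eq_UNIV_iff
  proof (intro allI impI)
    fix U :: "real set"
    assume "open U" "U \<noteq> {}"
    then have "to_circle ` U \<inter> F k \<noteq> {}"
      using dense[of k] open_to_circle_image[of U] unfolding closure_eq_UNIV_iff by blast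
    then show "U \<inter> to_circle -` F k \<noteq> {}" by blast
  qed
  have "UNIV \<subseteq> closure (\<Inter>(range (\<lambda>k. to_circle -` F k)))"
    by (rule Baire) (use op dense_lift in \<open>auto simp: open_circle_def\<close>)
  then have lift: "closure (\<Inter>k. to_circle -` F k) = UNIV"
    by blast
  show ?thesis
    unfolding closure_eq_UNIV_iff
  proof (intro allI impI)
    fix U :: "circle set"
    assume U: "open U" "U \<noteq> {}"
    then obtain x where "to_circle x \<in> U"
      by (metis circle_cases ex_in_conv)
    with U have "open (to_circle -` U)" "to_circle -` U \<noteq> {}"
      by (auto simp: open_circle_def)
    then have "to_circle -` U \<inter> (\<Inter>k. to_circle -` F k) \<noteq> {}"
      using lift unfolding closure_eq_UNIV_iff by blast
    then show "U \<inter> (\<Inter>k. F k) \<noteq> {}" by blast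
  qed
qed

section \<open>Pointwise convergence along subsequences\<close>

text \<open>
  The single lower bound \<open>j \<ge> k\<close> is enough for picking indices that increase strictly: to pass an
  index \<open>j\<close>, apply the hypothesis at \<open>max k (j + 1)\<close>, which also keeps the tolerance below
  \<open>1 / (k + 1)\<close>.
\<close>
lemma ex_strict_mono_tendsto:
  fixes a :: "nat \<Rightarrow> 'a::metric_space"
  assumes "\<And>k. \<exists>j\<ge>k. dist (a j) l < 1 / Suc k"
  shows "\<exists>r. strict_mono r \<and> (\<lambda>j. a (r j)) \<longlonglongrightarrow> l"
proof -
  have step: "\<exists>j'. dist (a j') l < 1 / Suc k \<and> j < j'" for j k
  proof -
    obtain i where i: "i \<ge> max k (Suc j)" "dist (a i) l < 1 / Suc (max k (Suc j))"
      using assms by blast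
    have "1 / real (Suc (max k (Suc j))) \<le> 1 / real (Suc k)"
      by (simp add: frac_le)
    with i show ?thesis by (intro exI[of _ i]) auto
  qed
  have "\<exists>r. \<forall>k. dist (a (r k)) l < 1 / Suc k \<and> r k < r (Suc k)"
    by (rule dependent_nat_choice) (use step in blast)+
  then obtain r where r: "\<And>k. dist (a (r k)) l < 1 / Suc k" "\<And>k. r k < r (Suc k)"
    by blast
  have "(\<lambda>j. a (r j)) \<longlonglongrightarrow> l"
  proof (rule metric_tendsto_imp_tendsto)
    show "(\<lambda>k. 1 / real (Suc k)) \<longlonglongrightarrow> 0"
      by (rule LIMSEQ_Suc[OF lim_1_over_n])
    show "\<forall>\<^sub>F k in sequentially. dist (a (r k)) l \<le> dist (1 / real (Suc k)) 0"
      using r(1) by (intro always_eventually) (simp add: dist_real_def less_imp_le)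
  qed
  with r(2) show ?thesis
    by (auto simp: strict_mono_Suc_iff)
qed

theorem proposition1:
  fixes f :: "circle \<Rightarrow> complex" and n :: "nat \<Rightarrow> nat"
  assumes "continuous_on UNIV f"
    and "strict_mono n"
  shows "\<exists>E :: circle set. gdelta E \<and> closure E = UNIV \<and>
           (\<forall>t\<in>E. \<exists>r :: nat \<Rightarrow> nat. strict_mono r \<and>
              (\<lambda>j. fourier_partial_sum (n (r j)) f t) \<longlonglongrightarrow> f t)"
proof -
  define F where
    "F = (\<lambda>k. \<Union>j\<in>{k..}. {t. dist (fourier_partial_sum (n j) f t) (f t) < 1 / Suc k})"
  have s: "continuous_on UNIV (fourier_partial_sum N f)" for N
    by (rule continuous_trig_poly[OF trig_poly_fourier_partial_sum])
  have op: "open (F k)" for k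
    unfolding F_def by (intro open_UN ballI open_Collect_less continuous_intros s assms(1))
  have dense: "closure (F k) = UNIV" for k
  proof (rule ccontr)
    assume "closure (F k) \<noteq> UNIV"
    then have "- closure (F k) \<noteq> {}" by blast
    then obtain c d where cd: "0 \<le> c" "c < d" "d \<le> 2 * pi" "to_circle ` {c..d} \<subseteq> - closure (F k)"
      by (rule open_circle_contains_arc[OF open_Compl[OF closed_closure]])
    \<comment> \<open>The square integral that an error of \<open>1 / (k + 1)\<close> throughout the arc would produce.\<close>
    define e where "e = (d - c) * (1 / Suc k)\<^sup>2"
    have "0 < e"
      using cd by (simp add: e_def)
    have "(\<lambda>j. square_integral (\<lambda>t. f t - fourier_partial_sum (n j) f t)) \<longlonglongrightarrow> 0"
      using LIMSEQ_subseq_LIMSEQ[OF square_integral_partial_sum_tendsto_0[OF assms(1)] assms(2)]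
      by (simp add: comp_def)
    then have "\<forall>\<^sub>F j in sequentially. square_integral (\<lambda>t. f t - fourier_partial_sum (n j) f t) < e"
      using \<open>0 < e\<close> by (rule order_tendstoD)
    then obtain j where j: "j \<ge> k" "square_integral (\<lambda>t. f t - fourier_partial_sum (n j) f t) < e"
      unfolding eventually_sequentially by (meson max.cobounded1 max.cobounded2)
    have "e \<le> square_integral (\<lambda>t. f t - fourier_partial_sum (n j) f t)"
      unfolding e_def
    proof (rule square_integral_ge_arc)
      fix x
      assume "x \<in> {c..d}"
      with cd(4) have "to_circle x \<notin> F k"
        using closure_subset by blast
      with j(1) show "1 / Suc k \<le> norm (f (to_circle x) - fourier_partial_sum (n j) f (to_circle x))"
        by (auto simp: F_def dist_norm norm_minus_commute not_less)
    qed (use cd in \<open>auto intro!: continuous_intros s assms(1)\<close>)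
    with j(2) show False by simp
  qed
  show ?thesis
  proof (rule exI[of _ "\<Inter>k. F k"], intro conjI ballI)
    show "gdelta (\<Inter>k. F k)"
      by (rule gdelta.intros) (rule op)
    show "closure (\<Inter>k. F k) = UNIV"
      by (rule circle_Baire[OF op dense])
    show "\<exists>r. strict_mono r \<and> (\<lambda>j. fourier_partial_sum (n (r j)) f t) \<longlonglongrightarrow> f t"
      if "t \<in> (\<Inter>k. F k)" for t
      using that by (intro ex_strict_mono_tendsto) (auto simp: F_def)
  qed
qed

end
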